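(* Let $k$ be a field with $\operatorname{char}k>d$, and let $M$ be a $d\times(2d-1)$ matrix over $k$ such that the permanent of every $d\times d$ submatrix of $M$ is zero. Then for any row of $M$, either some entry in that row is zero, or the permanents of all the $(d-1)\times(d-1)$ submatrices of the $(d-1)\times(2d-1)$ matrix formed by the other $d-1$ rows are zero.
   Context: The permanent of an $n\times n$ matrix $(a_{i,j})$ over a commutative ring is $\sum_{\sigma\in S_n}a_{1,\sigma(1)}\cdots a_{n,\sigma(n)}$. *)

theory Defs
  imports "Jordan_Normal_Form.DL_Submatrix"
begin

text \<open>As for the library's determinant, indices start at 0 and a non-square matrix is
  sent to the junk value 0.\<close>

definition permanent :: "'a :: comm_ring_1 mat \<Rightarrow> 'a" where
  "permanent A = (if dim_row A = dim_col A then
     (\<Sum>p \<in> {p. p permutes {0..<dim_row A}}. \<Prod>i = 0..<dim_row A. A $$ (i, p i)) else 0)"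

definition submatrices :: "nat \<Rightarrow> nat \<Rightarrow> 'a mat \<Rightarrow> 'a mat set" where
  "submatrices r c A = {submatrix A I J | I J.
     I \<subseteq> {0..<dim_row A} \<and> card I = r \<and> J \<subseteq> {0..<dim_col A} \<and> card J = c}"

lemma submatrices_carrier: "submatrices r c A \<subseteq> carrier_mat r c"
proof
  fix B assume "B \<in> submatrices r c A"
  then obtain I J where B: "B = submatrix A I J"
    and I: "I \<subseteq> {0..<dim_row A}" "card I = r"
    and J: "J \<subseteq> {0..<dim_col A}" "card J = c"
    unfolding submatrices_def by blast
  have "{i. i < dim_row A \<and> i \<in> I} = I" "{j. j < dim_col A \<and> j \<in> J} = J"
    using I J by auto
  then show "B \<in> carrier_mat r c"
    using I J by (auto simp: B dim_submatrix intro: carrier_matI)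
qed

definition remove_row :: "nat \<Rightarrow> 'a mat \<Rightarrow> 'a mat" where
  "remove_row i A = submatrix A ({0..<dim_row A} - {i}) {0..<dim_col A}"

end

theory Submission
  imports Defs
begin

text \<open>Expand the permanents along the chosen row, whose entries are nonzero. For a
  \<open>(d-1)\<close>-set \<open>L\<close> of columns, let \<open>f L\<close> be the permanent of the other rows on the columns \<open>L\<close>,
  divided by the product of the entries of the chosen row in these columns. Then the values of \<open>f\<close> on the \<open>(d-1)\<close>-subsets of any
  \<open>d\<close>-set of columns sum to zero. For a fixed \<open>(d-1)\<close>-set \<open>K\<close>, let \<open>T\<^sub>i\<close> be the sum of \<open>f\<close> over the
  \<open>(d-1)\<close>-sets that meet \<open>K\<close> in \<open>i\<close> points. Adding the relations of all \<open>d\<close>-sets that meet \<open>K\<close>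
  in \<open>i\<close> points yields \<open>(i+1) T\<^sub>i + (d-i) T\<^bsub>i-1\<^esub> = 0\<close>, so every \<open>T\<^sub>i\<close> vanishes when
  \<open>1, \<dots>, d\<close> are invertible, and \<open>T\<^bsub>d-1\<^esub> = f K\<close>.\<close>

section \<open>Counting subsets by their intersection with a fixed set\<close>

lemma card_insert_extensions:
  assumes X: "finite X" "card X = 2 * d - 1" and d: "d \<ge> 1"
    and K: "K \<subseteq> X" "card K = d - 1" and L: "L \<subseteq> X" "card L = d - 1"
  shows "card {j \<in> X - L. card (insert j L \<inter> K) = i} =
    (if card (L \<inter> K) = i then i + 1 else if Suc (card (L \<inter> K)) = i then d - i else 0)"
proof -
  have fin: "finite L" "finite K" using X(1) K L by (auto intro: finite_subset)
  \<comment> \<open>An added point raises the intersection number exactly when it lies in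
    \<open>K\<close>. So the points to count form \<open>X - L - K\<close> if \<open>L\<close>
    already meets \<open>K\<close> in \<open>i\<close> points, and \<open>K - L\<close> if it is one
    short. The two counts become the coefficients of the recurrence below.\<close>
  have c: "card (insert j L \<inter> K) = (if j \<in> K then Suc (card (L \<inter> K)) else card (L \<inter> K))"
    if "j \<notin> L" for j
    using that fin by auto
  \<comment> \<open>This is where the size \<open>2 * d - 1\<close> matters: the union of
    \<open>L\<close> and \<open>K\<close> has \<open>2 * d - 2\<close> points less those in common,
    so its complement in \<open>X\<close> has one point more than the intersection.\<close>
  have out: "card (X - L - K) = card (L \<inter> K) + 1"
  proof -
    have "card (X - (L \<union> K)) = 2 * d - 1 - card (L \<union> K)"
      using X K L fin by (subst card_Diff_subset) auto
    moreover have "card (L \<union> K) + card (L \<inter> K) = 2 * d - 2"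
      using card_Un_Int[OF fin] K L by simp
    moreover have "card (L \<inter> K) \<le> d - 1"
      using card_mono[of K "L \<inter> K"] fin K by simp
    moreover have "X - L - K = X - (L \<union> K)" by blast
    ultimately show ?thesis using d by simp
  qed
  have ins: "card (K - L) = d - 1 - card (L \<inter> K)"
    using fin K by (simp add: card_Diff_subset_Int Int_commute)
  have C: "{j \<in> X - L. card (insert j L \<inter> K) = i} =
      {j \<in> X - L. (if j \<in> K then Suc (card (L \<inter> K)) else card (L \<inter> K)) = i}"
    by (intro Collect_cong conj_cong refl, subst c) auto
  consider "card (L \<inter> K) = i" | "Suc (card (L \<inter> K)) = i"
    | "card (L \<inter> K) \<noteq> i" "Suc (card (L \<inter> K)) \<noteq> i" by blast
  then show ?thesis
  proof cases
    case 1
    then have "{j \<in> X - L. card (insert j L \<inter> K) = i} = X - L - K"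
      unfolding C by (auto split: if_splits)
    then show ?thesis using out 1 by simp
  next
    case 2
    then have "{j \<in> X - L. card (insert j L \<inter> K) = i} = K - L"
      unfolding C using K by (auto split: if_splits)
    then show ?thesis using ins 2 d by auto
  next
    case 3
    then have "{j \<in> X - L. card (insert j L \<inter> K) = i} = {}"
      unfolding C by (auto split: if_splits)
    then show ?thesis using 3 by (simp only: card.empty if_False)
  qed
qed

lemma subset_sums_zero_imp_zero:
  fixes f :: "'b set \<Rightarrow> 'a :: idom"
  assumes X: "finite X" "card X = 2 * d - 1" and d: "d \<ge> 1"
    and nz: "\<And>m. 1 \<le> m \<Longrightarrow> m \<le> d \<Longrightarrow> (of_nat m :: 'a) \<noteq> 0"
    and f: "\<And>J. J \<subseteq> X \<Longrightarrow> card J = d \<Longrightarrow> (\<Sum>j\<in>J. f (J - {j})) = 0"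
    and K: "K \<subseteq> X" "card K = d - 1"
  shows "f K = 0"
proof -
  define A where "A = {L. L \<subseteq> X \<and> card L = d - 1}"
  define T where "T i = (\<Sum>L\<in>{L \<in> A. card (L \<inter> K) = i}. f L)" for i
  \<comment> \<open>\<open>T'\<close> is \<open>T\<close> shifted by one. Writing the shift with
    \<open>Suc\<close> makes \<open>T' 0\<close> an empty sum, whereas \<open>T (i - 1)\<close> at
    \<open>i = 0\<close> would be \<open>T 0\<close> by truncated subtraction.\<close>
  define T' where "T' i = (\<Sum>L\<in>{L \<in> A. Suc (card (L \<inter> K)) = i}. f L)" for i
  have finA: "finite A" unfolding A_def using X by auto
  have rec: "of_nat (i + 1) * T i + of_nat (d - i) * T' i = 0" for i
  proof -
    let ?B = "{J. J \<subseteq> X \<and> card J = d \<and> card (J \<inter> K) = i}"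
    let ?C = "\<lambda>L. {j \<in> X - L. card (insert j L \<inter> K) = i}"
    have finB: "finite ?B" using X by auto
    have "0 = (\<Sum>J\<in>?B. \<Sum>j\<in>J. f (J - {j}))" using f by (simp add: sum.neutral)
    also have "\<dots> = (\<Sum>(J, j)\<in>Sigma ?B (\<lambda>J. J). f (J - {j}))"
      using finB X by (subst sum.Sigma) (auto intro: finite_subset)
    \<comment> \<open>Double counting: a set \<open>J\<close> with a marked point \<open>j\<close>
      is the same as the smaller set \<open>J - {j}\<close> with a point to be added. Summing over
      \<open>j\<close> first then multiplies each \<open>f L\<close> by the cardinality of
      \<open>?C L\<close>.\<close>
    also have "\<dots> = (\<Sum>(L, j)\<in>Sigma A ?C. f L)"
    proof (rule sum.reindex_bij_witness[where
        i = "\<lambda>(L, j). (insert j L, j)" and j = "\<lambda>(J, j). (J - {j}, j)"], goal_cases)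
      case (4 b)
      obtain L j where b: "b = (L, j)" "L \<subseteq> X" "card L = d - 1" "j \<in> X - L"
        "card (insert j L \<inter> K) = i"
        using 4 by (auto simp: A_def)
      have "finite L" using b X by (auto intro: finite_subset)
      then show ?case using b d by auto
    qed (use X d in \<open>auto simp: A_def insert_absorb\<close>)
    also have "\<dots> = (\<Sum>L\<in>A. \<Sum>j\<in>?C L. f L)"
      using finA X by (subst sum.Sigma) auto
    also have "\<dots> = (\<Sum>L\<in>A. (if card (L \<inter> K) = i then of_nat (i + 1) * f L else 0)
        + (if Suc (card (L \<inter> K)) = i then of_nat (d - i) * f L else 0))"
    proof (rule sum.cong[OF refl])
      fix L assume "L \<in> A"
      then show "(\<Sum>j\<in>?C L. f L) = (if card (L \<inter> K) = i then of_nat (i + 1) * f L else 0)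
        + (if Suc (card (L \<inter> K)) = i then of_nat (d - i) * f L else 0)"
        using card_insert_extensions[OF X d K, of L i] by (simp add: A_def)
    qed
    also have "\<dots> = of_nat (i + 1) * T i + of_nat (d - i) * T' i"
      unfolding T_def T'_def sum.distrib sum_distrib_left
      using finA by (simp only: sum.inter_filter)
    finally show ?thesis by simp
  qed
  \<comment> \<open>The bound keeps the leading coefficient \<open>i + 1\<close> between 1 and
    \<open>d\<close>, where \<open>nz\<close> lets it be cancelled.\<close>
  have "T i = 0" if "i < d" for i
    using that
  proof (induction i)
    case 0
    have "T' 0 = 0" by (simp add: T'_def)
    then show ?case using rec[of 0] by simp
  next
    case (Suc i)
    have "T' (Suc i) = T i" by (simp add: T'_def T_def)
    then have "of_nat (Suc i + 1) * T (Suc i) = 0"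
      using rec[of "Suc i"] Suc by simp
    then show ?case using nz[of "Suc i + 1"] Suc.prems by (simp only: mult_eq_0_iff) auto
  qed
  then have "T (d - 1) = 0" using d by simp
  moreover have "{L \<in> A. card (L \<inter> K) = d - 1} = {K}"
  proof -
    have "L = K" if "L \<in> A" "card (L \<inter> K) = d - 1" for L
    proof -
      have fin: "finite L" "finite K" using X K that by (auto simp: A_def intro: finite_subset)
      have "L \<inter> K = L" using that fin by (intro card_subset_eq) (auto simp: A_def)
      moreover have "L \<inter> K = K" using that K fin by (intro card_subset_eq) auto
      ultimately show ?thesis by simp
    qed
    then show ?thesis using K by (auto simp: A_def)
  qed
  ultimately show ?thesis by (simp add: T_def)
qed

section \<open>Permanents with arbitrary finite row and column sets\<close>

text \<open>With sets as indices, deleting a row or a column is a set difference and nothing is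
  renumbered. Restricting to \<open>extensional I\<close> fixes the values outside \<open>I\<close>,
  so each bijection is counted once.\<close>

definition bij_permanent :: "('b \<Rightarrow> 'c \<Rightarrow> 'a :: comm_ring_1) \<Rightarrow> 'b set \<Rightarrow> 'c set \<Rightarrow> 'a" where
  "bij_permanent m I J = (\<Sum>f \<in> {f \<in> extensional I. bij_betw f I J}. \<Prod>i\<in>I. m i (f i))"

lemma finite_extensional_bij_betw:
  assumes "finite I" "finite J"
  shows "finite {f \<in> extensional I. bij_betw f I J}"
  by (rule finite_subset[OF _ finite_PiE[of I "\<lambda>_. J"]])
    (use assms in \<open>auto simp: PiE_def bij_betw_def\<close>)

text \<open>Laplace expansion along row \<open>i\<close>, without signs: a bijection amounts to the
  image of \<open>i\<close> together with its restriction to the remaining rows, and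
  \<open>g(i := j)\<close> reassembles it.\<close>

lemma bij_permanent_expand:
  assumes fin: "finite I" "finite J" and i: "i \<in> I"
  shows "bij_permanent m I J = (\<Sum>j\<in>J. m i j * bij_permanent m (I - {i}) (J - {j}))"
proof -
  let ?F = "\<lambda>I J. {f \<in> extensional I. bij_betw f I J}"
  have "bij_permanent m I J = (\<Sum>f\<in>?F I J. m i (f i) * (\<Prod>k\<in>I - {i}. m k (f k)))"
    unfolding bij_permanent_def using fin i by (simp add: prod.remove)
  also have "\<dots> = (\<Sum>(j, g)\<in>Sigma J (\<lambda>j. ?F (I - {i}) (J - {j})).
      m i j * (\<Prod>k\<in>I - {i}. m k (g k)))"
  proof (rule sum.reindex_bij_witness[where
      i = "\<lambda>(j, g). g(i := j)" and j = "\<lambda>f. (f i, restrict f (I - {i}))"], goal_cases)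
    case (1 f)
    then show ?case by (auto simp: extensional_def restrict_def fun_eq_iff)
  next
    case (2 f)
    then have "bij_betw f (I - {i}) (J - {f i})"
      using i by (auto simp: bij_betw_def inj_on_def)
    then show ?case using 2 i by (auto simp: bij_betw_def)
  next
    case (3 p)
    then show ?case by (auto simp: extensional_def restrict_def fun_eq_iff)
  next
    case (4 p)
    obtain j g where p: "p = (j, g)" "j \<in> J" "g \<in> extensional (I - {i})"
      "bij_betw g (I - {i}) (J - {j})"
      using 4 by auto
    have "bij_betw (g(i := j)) (insert i (I - {i})) (insert j (J - {j}))"
      using p(4) by (auto simp: bij_betw_def inj_on_def)
    then show ?case using p i by (auto simp: insert_absorb extensional_def)
  next
    case (5 f)
    then show ?case by simp
  qed
  also have "\<dots> = (\<Sum>j\<in>J. m i j * bij_permanent m (I - {i}) (J - {j}))"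
    unfolding bij_permanent_def sum_distrib_left
    using fin by (subst sum.Sigma) (auto intro!: finite_extensional_bij_betw)
  finally show ?thesis .
qed

text \<open>Conjugating by the numberings turns a permutation \<open>p\<close> into the bijection
  that sends \<open>r a\<close> to \<open>c (p a)\<close>. Since \<open>r\<close> and
  \<open>c\<close> are arbitrary, the permanent does not depend on the order of rows and
  columns.\<close>

lemma sum_permutations_eq_bij_permanent:
  fixes m :: "'b \<Rightarrow> 'c \<Rightarrow> 'a :: comm_ring_1"
  assumes r: "bij_betw r {0..<n} I" and c: "bij_betw c {0..<n} J"
  shows "(\<Sum>p\<in>{p. p permutes {0..<n}}. \<Prod>a = 0..<n. m (r a) (c (p a))) = bij_permanent m I J"
proof -
  let ?N = "{0..<n}"
  let ?r = "the_inv_into ?N r" and ?c = "the_inv_into ?N c"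
  have r': "bij_betw ?r I ?N" and c': "bij_betw ?c J ?N"
    using r c by (simp_all add: bij_betw_the_inv_into)
  have rr: "?r (r a) = a" "?c (c a) = a" if "a \<in> ?N" for a
    using that r c by (auto simp: bij_betw_def the_inv_into_f_f simp del: atLeastLessThan_iff)
  have rI: "r (?r x) = x" "?r x \<in> ?N" if "x \<in> I" for x
    using that r r' by (auto simp: f_the_inv_into_f_bij_betw bij_betw_apply simp del: atLeastLessThan_iff)
  have cJ: "c (?c y) = y" "?c y \<in> ?N" if "y \<in> J" for y
    using that c c' by (auto simp: f_the_inv_into_f_bij_betw bij_betw_apply simp del: atLeastLessThan_iff)
  have rN: "r a \<in> I" "c a \<in> J" if "a \<in> ?N" for a
    using that r c by (auto simp: bij_betw_def)
  show ?thesis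
    unfolding bij_permanent_def
  proof (rule sum.reindex_bij_witness[where
      j = "\<lambda>p. restrict (c \<circ> p \<circ> ?r) I"
      \<comment> \<open>The inverse map must return \<open>a\<close> itself outside
        \<open>?N\<close>, because \<open>permutes\<close> demands the identity there.\<close>
      and i = "\<lambda>f a. if a \<in> ?N then ?c (f (r a)) else a"], goal_cases)
    case (1 p)
    then have "p a \<in> ?N \<longleftrightarrow> a \<in> ?N" "a \<notin> ?N \<longrightarrow> p a = a" for a
      by (auto simp: permutes_in_image permutes_def simp del: atLeastLessThan_iff)
    then show ?case using rr rN by (auto simp: fun_eq_iff simp del: atLeastLessThan_iff)
  next
    case (2 p)
    then have "bij_betw p ?N ?N" by (simp add: permutes_imp_bij)
    then have "bij_betw (c \<circ> p \<circ> ?r) I J"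
      using r' c by (blast intro: bij_betw_trans)
    then show ?case by (simp add: bij_betw_cong[of I "restrict (c \<circ> p \<circ> ?r) I" "c \<circ> p \<circ> ?r"])
  next
    case (3 f)
    then have "f x \<in> J" if "x \<in> I" for x using that by (auto simp: bij_betw_def)
    then show ?case using 3 rI cJ
      by (auto simp: fun_eq_iff extensional_def simp del: atLeastLessThan_iff)
  next
    case (4 f)
    then have "bij_betw (?c \<circ> f \<circ> r) ?N ?N"
      using r c' by (blast intro: bij_betw_trans)
    then have "bij_betw (\<lambda>a. if a \<in> ?N then ?c (f (r a)) else a) ?N ?N"
      by (subst bij_betw_cong[of _ _ "?c \<circ> f \<circ> r"]) auto
    then show ?case by (auto intro!: bij_imp_permutes)
  next
    case (5 p)
    have "(\<Prod>i\<in>I. m i (c (p (?r i)))) = (\<Prod>a\<in>?N. m (r a) (c (p (?r (r a)))))"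
      by (rule prod.reindex_bij_betw[OF r, symmetric])
    also have "\<dots> = (\<Prod>a\<in>?N. m (r a) (c (p a)))"
      by (rule prod.cong) (use rr in auto)
    finally show ?case by simp
  qed
qed

section \<open>From submatrices to index sets\<close>

lemma bij_betw_pick:
  assumes "finite I" "card I = n"
  shows "bij_betw (pick I) {0..<n} I"
proof -
  have "inj_on (pick I) {0..<n}"
    using assms by (auto simp: inj_on_def) (metis nat_neq_iff pick_mono)
  moreover have "pick I ` {0..<n} \<subseteq> I"
    using assms by (auto intro: pick_in_set)
  moreover have "card (pick I ` {0..<n}) = card I"
    using calculation(1) assms by (simp add: card_image)
  ultimately show ?thesis
    unfolding bij_betw_def using assms card_subset_eq by blast
qed

lemma permanent_submatrix:
  assumes I: "I \<subseteq> {0..<dim_row A}" "card I = n" and J: "J \<subseteq> {0..<dim_col A}" "card J = n"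
  shows "permanent (submatrix A I J) = bij_permanent (\<lambda>i j. A $$ (i, j)) I J"
proof -
  have eq: "{i. i < dim_row A \<and> i \<in> I} = I" "{j. j < dim_col A \<and> j \<in> J} = J"
    using I J by auto
  have fin: "finite I" "finite J" using I J by (auto intro: finite_subset)
  have "permanent (submatrix A I J) = (\<Sum>p\<in>{p. p permutes {0..<n}}.
      \<Prod>a = 0..<n. A $$ (pick I a, pick J (p a)))"
  proof -
    have "submatrix A I J $$ (a, p a) = A $$ (pick I a, pick J (p a))"
      if "p permutes {0..<n}" "a < n" for p a
      using that permutes_in_image[OF that(1), of a] I J eq by (subst submatrix_index) auto
    then show ?thesis
      using I J eq by (auto simp: permanent_def dim_submatrix intro!: sum.cong prod.cong)
  qed
  also have "\<dots> = bij_permanent (\<lambda>i j. A $$ (i, j)) I J"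
    by (rule sum_permutations_eq_bij_permanent) (use fin I J bij_betw_pick in auto)
  finally show ?thesis .
qed

text \<open>Columns are selected twice here, once by \<open>remove_row\<close> and once by the
  submatrix. The composed selection is one numbering of the image \<open>K\<close> of
  \<open>J\<close>, and any numbering gives the same permanent.\<close>

lemma permanent_submatrix_remove_row:
  assumes A: "A \<in> carrier_mat (Suc n) c" and i: "i < Suc n"
    and N: "N \<in> submatrices n n (remove_row i A)"
  obtains K where "K \<subseteq> {0..<c}" "card K = n"
    "permanent N = bij_permanent (\<lambda>i j. A $$ (i, j)) ({0..<Suc n} - {i}) K"
proof -
  let ?R = "{0..<Suc n} - {i}"
  let ?B = "remove_row i A"
  have eq: "{k. k < Suc n \<and> k \<in> ?R} = ?R" "{j. j < c \<and> j \<in> {0..<c}} = {0..<c}"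
    by auto
  have R: "card ?R = n" using i by simp
  have dim: "dim_row ?B = n" "dim_col ?B = c"
    using A R eq by (simp_all add: remove_row_def dim_submatrix)
  have ent: "?B $$ (a, b) = A $$ (pick ?R a, pick {0..<c} b)" if "a < n" "b < c" for a b
    using that A R eq unfolding remove_row_def by (subst submatrix_index) auto
  obtain I J where N: "N = submatrix ?B I J" and I: "I \<subseteq> {0..<n}" "card I = n"
    and J: "J \<subseteq> {0..<c}" "card J = n"
    using N dim unfolding submatrices_def by auto
  have I_eq: "I = {0..<n}" using I by (intro card_subset_eq) auto
  have r: "bij_betw (pick ?R) {0..<n} ?R" using R by (intro bij_betw_pick) auto
  have c: "bij_betw (pick {0..<c}) {0..<c} {0..<c}" by (intro bij_betw_pick) auto
  let ?K = "pick {0..<c} ` J"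
  have K: "?K \<subseteq> {0..<c}" using c J by (auto simp: bij_betw_def)
  have cJ: "bij_betw (pick {0..<c}) J ?K" by (rule bij_betw_subset[OF c J(1) refl])
  have finJ: "finite J" using J by (auto intro: finite_subset)
  have pJ: "bij_betw (pick J) {0..<n} J" using J finJ by (intro bij_betw_pick) auto
  have "permanent N = bij_permanent (\<lambda>a b. ?B $$ (a, b)) I J"
    unfolding N using I J dim by (intro permanent_submatrix) auto
  \<comment> \<open>All \<open>n\<close> rows of \<open>?B\<close> are selected, so
    \<open>id\<close> can serve as the numbering of \<open>I\<close>.\<close>
  also have "\<dots> = (\<Sum>p\<in>{p. p permutes {0..<n}}. \<Prod>a = 0..<n. ?B $$ (id a, pick J (p a)))"
    by (rule sum_permutations_eq_bij_permanent[symmetric]) (use I_eq pJ in \<open>auto simp: id_def bij_betw_def\<close>)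
  also have "\<dots> = (\<Sum>p\<in>{p. p permutes {0..<n}}.
      \<Prod>a = 0..<n. A $$ (pick ?R a, (pick {0..<c} \<circ> pick J) (p a)))"
  proof (intro sum.cong prod.cong refl)
    fix p a assume p: "p \<in> {p. p permutes {0..<n}}" and a: "a \<in> {0..<n}"
    then have "pick J (p a) \<in> J" using pJ permutes_in_image[of p "{0..<n}" a]
      by (auto simp: bij_betw_def)
    then show "?B $$ (id a, pick J (p a)) = A $$ (pick ?R a, (pick {0..<c} \<circ> pick J) (p a))"
      using ent a J by auto
  qed
  also have "\<dots> = bij_permanent (\<lambda>i j. A $$ (i, j)) ?R ?K"
    by (rule sum_permutations_eq_bij_permanent[OF r bij_betw_trans[OF pJ cJ]])
  finally have "permanent N = bij_permanent (\<lambda>i j. A $$ (i, j)) ?R ?K" .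
  moreover have "card ?K = n" using bij_betw_same_card[OF cJ] J by simp
  ultimately show thesis using that K by blast
qed

theorem corollary7:
  fixes M :: "'k :: field mat" and d :: nat
  assumes "d \<ge> 1"
    and "CHAR('k) > d"
    and "M \<in> carrier_mat d (2 * d - 1)"
    and "\<forall>N \<in> submatrices d d M. permanent N = 0"
  shows "\<forall>i < d. (\<exists>j < 2 * d - 1. M $$ (i, j) = 0) \<or>
    (\<forall>N \<in> submatrices (d - 1) (d - 1) (remove_row i M). permanent N = 0)"
proof (intro allI impI)
  fix i assume i: "i < d"
  let ?m = "\<lambda>i j. M $$ (i, j)" and ?X = "{0..<2 * d - 1}"
  let ?P = "bij_permanent ?m ({0..<d} - {i})"
  have of_nat_nz: "(of_nat k :: 'k) \<noteq> 0" if "1 \<le> k" "k \<le> d" for k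
    using that assms(2) by (auto simp: of_nat_eq_0_iff_char_dvd dest: dvd_imp_le)
  have "permanent N = 0" if nz: "\<forall>j < 2 * d - 1. M $$ (i, j) \<noteq> 0"
    and N: "N \<in> submatrices (d - 1) (d - 1) (remove_row i M)" for N
  proof -
    \<comment> \<open>The lemma speaks of \<open>Suc n\<close> rows; \<open>d \<ge> 1\<close> turns
      \<open>Suc (d - 1)\<close> into \<open>d\<close>.\<close>
    obtain K where K: "K \<subseteq> ?X" "card K = d - 1" and N_eq: "permanent N = ?P K"
      using permanent_submatrix_remove_row[of M "d - 1" "2 * d - 1" i N] assms(1,3) i N by auto
    have rel: "(\<Sum>j\<in>J. ?P (J - {j}) / (\<Prod>k\<in>J - {j}. ?m i k)) = 0"
      if J: "J \<subseteq> ?X" "card J = d" for J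
    proof -
      have fin: "finite J" using J by (auto intro: finite_subset)
      have "submatrix M {0..<d} J \<in> submatrices d d M"
        using J assms(3) by (force simp: submatrices_def)
      then have "0 = permanent (submatrix M {0..<d} J)" using assms(4) by simp
      also have "\<dots> = bij_permanent ?m {0..<d} J"
        using J assms(3) by (intro permanent_submatrix) auto
      also have "\<dots> = (\<Sum>j\<in>J. ?m i j * ?P (J - {j}))"
        using fin i by (intro bij_permanent_expand) auto
      \<comment> \<open>Dividing by the product over all of \<open>J\<close> cancels the entry
        \<open>?m i j\<close> in the term of \<open>j\<close>. What is left depends on
        \<open>J - {j}\<close> alone, as the subset-sum lemma requires.\<close>
      finally have "0 = (\<Sum>j\<in>J. ?m i j * ?P (J - {j})) / (\<Prod>k\<in>J. ?m i k)" by simp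
      also have "\<dots> = (\<Sum>j\<in>J. ?P (J - {j}) / (\<Prod>k\<in>J - {j}. ?m i k))"
        unfolding sum_divide_distrib
      proof (rule sum.cong[OF refl])
        fix j assume j: "j \<in> J"
        then have "?m i j \<noteq> 0" using J nz by auto
        then show "?m i j * ?P (J - {j}) / (\<Prod>k\<in>J. ?m i k)
            = ?P (J - {j}) / (\<Prod>k\<in>J - {j}. ?m i k)"
          using prod.remove[OF fin j, of "?m i"] by simp
      qed
      finally show ?thesis by simp
    qed
    have "?P K / (\<Prod>k\<in>K. ?m i k) = 0"
      by (rule subset_sums_zero_imp_zero[where f = "\<lambda>K. ?P K / (\<Prod>k\<in>K. ?m i k)",
            OF _ _ assms(1) of_nat_nz rel K]) auto
    moreover have "(\<Prod>k\<in>K. ?m i k) \<noteq> 0"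
      using K nz finite_subset[OF K(1)] by auto
    ultimately show ?thesis using N_eq by simp
  qed
  then show "(\<exists>j < 2 * d - 1. M $$ (i, j) = 0) \<or>
    (\<forall>N \<in> submatrices (d - 1) (d - 1) (remove_row i M). permanent N = 0)"
    by blast
qed

end
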